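(* For all integers $n\ge k\ge 1$, the map $\psi:(\omega,\xi)\mapsto\pi$ is a bijection from $\Delta_n^k$ onto $\mathcal{OP}_n^k$ such that, writing the starting vertex of the $i$-th step of $\omega$ as $s_{i-1}=(p,q)$: (1) if the $i$-th step is North or East, then $i\in\mathcal O(\pi)\cup\mathcal S(\pi)$ and $(\mathrm{lcs}+\mathrm{rcs})_i(\pi)=p$, $(\mathrm{lsb}+\mathrm{rsb})_i(\pi)=q$, $\mathrm{los}_i(\pi)=\xi_i-1$, $\mathrm{ros}_i(\pi)=p+q+1-\xi_i$; (2) if the $i$-th step is South-East or Null, then $i\in\mathcal T(\pi)\cup\mathcal C(\pi)$ and $(\mathrm{lcs}+\mathrm{rcs})_i(\pi)=p$, $(\mathrm{lsb}+\mathrm{rsb})_i(\pi)=q-1$, $\mathrm{lsb}_i(\pi)=\xi_i-1$, $\mathrm{rsb}_i(\pi)=q-\xi_i$.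
   Context: Ordered partitions: $\mathcal{OP}_n^k$ is the set of sequences $\pi=(B_1,\dots,B_k)$ of nonempty pairwise disjoint sets with union $[n]$. Opener/closer = least/greatest element of a block; $\mathrm{open}(\pi)$, $\mathrm{clos}(\pi)$ their sets; $\mathrm{block}(i)=j$ iff $i\in B_j$. For $i\in[n]$: $\mathrm{ros}_i=\#\{j\in\mathrm{open}(\pi): j<i,\ \mathrm{block}(j)>\mathrm{block}(i)\}$, $\mathrm{los}_i=\#\{j\in\mathrm{open}(\pi): j<i,\ \mathrm{block}(j)<\mathrm{block}(i)\}$, $\mathrm{rcs}_i=\#\{j\in\mathrm{clos}(\pi): j<i,\ \mathrm{block}(j)>\mathrm{block}(i)\}$, $\mathrm{lcs}_i=\#\{j\in\mathrm{clos}(\pi): j<i,\ \mathrm{block}(j)<\mathrm{block}(i)\}$; $\mathrm{rsb}_i$ (resp. $\mathrm{lsb}_i$) is the number of blocks $B$ to the right (resp. left) of the block containing $i$ with $\min B<i<\max B$; $(s+s')_i=s_i+s'_i$. Types: an element forming a one-element block is a singleton (set $\mathcal S(\pi)$); in a block with at least two elements, the least element is a strict opener ($\mathcal O(\pi)$), the greatest a strict closer ($\mathcal C(\pi)$), and the others transients ($\mathcal T(\pi)$). Paths: $D_k$ is the digraph with vertices $\{(i,j)\in\mathbb N^2:i+j\le k\}$ and an edge from $(i,j)$ to $(i',j')$ iff $(i',j')=(i,j)$ with $j>0$, or $(i',j')\in\{(i,j+1),(i+1,j),(i+1,j-1)\}$. A path of depth $k$ and length $n$ is a sequence $\omega=(s_0,\dots,s_n)$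 of vertices with $s_0=(0,0)$, $s_n=(k,0)$ and each $(s_{i-1},s_i)$ an edge. The $i$-th step $(s_{i-1},s_i)$ with $s_{i-1}=(p,q)$ is North if $s_i=(p,q+1)$, East if $s_i=(p+1,q)$, South-East if $s_i=(p+1,q-1)$, Null if $s_i=s_{i-1}$. A path diagram of depth $k$ and length $n$ is a pair $(\omega,\xi)$ with $\omega$ such a path and $\xi=(\xi_1,\dots,\xi_n)$ integers with $1\le\xi_i\le q$ if the $i$-th step is Null or South-East and $1\le\xi_i\le p+q+1$ if it is North or East, where $s_{i-1}=(p,q)$; $\Delta_n^k$ is the set of these. The map $\psi$: a trace on $[i]$ is a sequence of nonempty pairwise disjoint sets with union $[i]$, each labeled opened or closed. Set $T_0$ to be the empty sequence. For $i=1,\dots,n$, with $s_{i-1}=(p,q)$, $T_{i-1}$ has $p$ closed and $q$ opened sets; number the $p+q+1$ gaps of $T_{i-1}$ (before the first set, between consecutive sets, after the last) $1,\dots,p+q+1$ from left to right, and number the opened sets $1,\dots,q$ from left to right. If the $i$-th step is North (resp. East), $T_i$ is obtained by inserting the set $\{i\}$ labeled opened (resp. closed) into gap $\xi_i$; if it is Null (resp. South-East), $T_i$ is obtained by adding $i$ to the $\xi_i$-th opened set, which stays opened (resp. becomes closed). Then $\psi(\omega,\xi)=T_n$, viewed as an ordered partition. *)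

theory Defs
  imports Main
begin

text \<open>An ordered partition is the list \<open>[B\<^sub>1, \<dots>, B\<^sub>k]\<close> of its blocks. Lists are 0-based, so the
  block called \<open>B\<^sub>j\<close> is \<open>\<pi> ! (j - 1)\<close>; block indices only enter through comparisons.\<close>

definition ordered_partitions :: "nat \<Rightarrow> nat \<Rightarrow> nat set list set" where
  "ordered_partitions n k =
     {\<pi>. length \<pi> = k
        \<and> (\<forall>j<k. \<pi> ! j \<noteq> {})
        \<and> (\<forall>j<k. \<forall>j'<k. j \<noteq> j' \<longrightarrow> \<pi> ! j \<inter> \<pi> ! j' = {})
        \<and> \<Union> (set \<pi>) = {1..n}}"

definition block :: "nat set list \<Rightarrow> nat \<Rightarrow> nat" where
  "block \<pi> i = (THE j. j < length \<pi> \<and> i \<in> \<pi> ! j)"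

definition openers :: "nat set list \<Rightarrow> nat set" where
  "openers \<pi> = Min ` set \<pi>"

definition closers :: "nat set list \<Rightarrow> nat set" where
  "closers \<pi> = Max ` set \<pi>"

definition ros :: "nat set list \<Rightarrow> nat \<Rightarrow> nat" where
  "ros \<pi> i = card {j \<in> openers \<pi>. j < i \<and> block \<pi> j > block \<pi> i}"

definition los :: "nat set list \<Rightarrow> nat \<Rightarrow> nat" where
  "los \<pi> i = card {j \<in> openers \<pi>. j < i \<and> block \<pi> j < block \<pi> i}"

definition rcs :: "nat set list \<Rightarrow> nat \<Rightarrow> nat" where
  "rcs \<pi> i = card {j \<in> closers \<pi>. j < i \<and> block \<pi> j > block \<pi> i}"

definition lcs :: "nat set list \<Rightarrow> nat \<Rightarrow> nat" where
  "lcs \<pi> i = card {j \<in> closers \<pi>. j < i \<and> block \<pi> j < block \<pi> i}"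

definition rsb :: "nat set list \<Rightarrow> nat \<Rightarrow> nat" where
  "rsb \<pi> i = card {b. b < length \<pi> \<and> b > block \<pi> i \<and> Min (\<pi> ! b) < i \<and> i < Max (\<pi> ! b)}"

definition lsb :: "nat set list \<Rightarrow> nat \<Rightarrow> nat" where
  "lsb \<pi> i = card {b. b < length \<pi> \<and> b < block \<pi> i \<and> Min (\<pi> ! b) < i \<and> i < Max (\<pi> ! b)}"

definition singletons :: "nat set list \<Rightarrow> nat set" where
  "singletons \<pi> = {i. {i} \<in> set \<pi>}"

definition strict_openers :: "nat set list \<Rightarrow> nat set" where
  "strict_openers \<pi> = {i. \<exists>B \<in> set \<pi>. 2 \<le> card B \<and> i = Min B}"

definition strict_closers :: "nat set list \<Rightarrow> nat set" where
  "strict_closers \<pi> = {i. \<exists>B \<in> set \<pi>. 2 \<le> card B \<and> i = Max B}"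

definition transients :: "nat set list \<Rightarrow> nat set" where
  "transients \<pi> = {i. \<exists>B \<in> set \<pi>. 2 \<le> card B \<and> i \<in> B \<and> i \<noteq> Min B \<and> i \<noteq> Max B}"


type_synonym vertex = "nat \<times> nat"

definition is_north :: "vertex \<Rightarrow> vertex \<Rightarrow> bool" where
  "is_north s t \<longleftrightarrow> t = (fst s, snd s + 1)"

definition is_east :: "vertex \<Rightarrow> vertex \<Rightarrow> bool" where
  "is_east s t \<longleftrightarrow> t = (fst s + 1, snd s)"

text \<open>The guard \<open>snd s > 0\<close> makes the truncated subtraction agree with the one on integers
  (there is no vertex with a negative coordinate).\<close>

definition is_south_east :: "vertex \<Rightarrow> vertex \<Rightarrow> bool" where
  "is_south_east s t \<longleftrightarrow> snd s > 0 \<and> t = (fst s + 1, snd s - 1)"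

definition is_null :: "vertex \<Rightarrow> vertex \<Rightarrow> bool" where
  "is_null s t \<longleftrightarrow> t = s"

definition D_verts :: "nat \<Rightarrow> vertex set" where
  "D_verts k = {(i, j). i + j \<le> k}"

definition D_edges :: "nat \<Rightarrow> (vertex \<times> vertex) set" where
  "D_edges k = {(s, t). s \<in> D_verts k \<and> t \<in> D_verts k \<and>
     (is_null s t \<and> snd s > 0 \<or> is_north s t \<or> is_east s t \<or> is_south_east s t)}"

definition paths :: "nat \<Rightarrow> nat \<Rightarrow> vertex list set" where
  "paths n k = {\<omega>. length \<omega> = n + 1 \<and> set \<omega> \<subseteq> D_verts k
     \<and> \<omega> ! 0 = (0, 0) \<and> \<omega> ! n = (k, 0)
     \<and> (\<forall>i\<in>{1..n}. (\<omega> ! (i - 1), \<omega> ! i) \<in> D_edges k)}"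

text \<open>A path is the list \<open>[s\<^sub>0, \<dots>, s\<^sub>n]\<close>, so \<open>s\<^sub>i\<close> is \<open>\<omega> ! i\<close>, whereas \<open>\<xi> = [\<xi>\<^sub>1, \<dots>, \<xi>\<^sub>n]\<close>,
  so \<open>\<xi>\<^sub>i\<close> is \<open>\<xi> ! (i - 1)\<close>.\<close>

definition path_diagrams :: "nat \<Rightarrow> nat \<Rightarrow> (vertex list \<times> nat list) set" where
  "path_diagrams n k = {(\<omega>, \<xi>). \<omega> \<in> paths n k \<and> length \<xi> = n
     \<and> (\<forall>i\<in>{1..n}. \<forall>p q. \<omega> ! (i - 1) = (p, q) \<longrightarrow>
          (is_null (p, q) (\<omega> ! i) \<or> is_south_east (p, q) (\<omega> ! i)
             \<longrightarrow> 1 \<le> \<xi> ! (i - 1) \<and> \<xi> ! (i - 1) \<le> q)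
        \<and> (is_north (p, q) (\<omega> ! i) \<or> is_east (p, q) (\<omega> ! i)
             \<longrightarrow> 1 \<le> \<xi> ! (i - 1) \<and> \<xi> ! (i - 1) \<le> p + q + 1))}"


datatype label = Opened | Closed

type_synonym trace = "(nat set \<times> label) list"

text \<open>Gap number \<open>g\<close> is preceded by exactly \<open>g - 1\<close> sets of the trace.\<close>

definition insert_gap :: "nat \<Rightarrow> nat set \<times> label \<Rightarrow> trace \<Rightarrow> trace" where
  "insert_gap g X T = take (g - 1) T @ X # drop (g - 1) T"

definition opened_pos :: "trace \<Rightarrow> nat \<Rightarrow> nat" where
  "opened_pos T m = filter (\<lambda>j. snd (T ! j) = Opened) [0..<length T] ! (m - 1)"

definition add_to_opened :: "nat \<Rightarrow> nat \<Rightarrow> label \<Rightarrow> trace \<Rightarrow> trace" where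
  "add_to_opened m i l T =
     (let j = opened_pos T m in T[j := (insert i (fst (T ! j)), l)])"

text \<open>Along an edge of the digraph the last case is exactly the South-East step.\<close>

definition trace_step :: "vertex \<Rightarrow> vertex \<Rightarrow> nat \<Rightarrow> nat \<Rightarrow> trace \<Rightarrow> trace" where
  "trace_step s t x i T =
     (if is_north s t then insert_gap x ({i}, Opened) T
      else if is_east s t then insert_gap x ({i}, Closed) T
      else if is_null s t then add_to_opened x i Opened T
      else add_to_opened x i Closed T)"

fun trace_of :: "vertex list \<Rightarrow> nat list \<Rightarrow> nat \<Rightarrow> trace" where
  "trace_of \<omega> \<xi> 0 = []"
| "trace_of \<omega> \<xi> (Suc i) =
     trace_step (\<omega> ! i) (\<omega> ! Suc i) (\<xi> ! i) (Suc i) (trace_of \<omega> \<xi> i)"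

definition psi :: "vertex list \<times> nat list \<Rightarrow> nat set list" where
  "psi = (\<lambda>(\<omega>, \<xi>). map fst (trace_of \<omega> \<xi> (length \<xi>)))"

end

theory Submission
  imports Defs
begin

text \<open>Every trace produced by \<open>psi\<close> is the restriction of the final partition to an initial segment
  \<open>{1..i}\<close>, where a block counts as closed iff it lies entirely in that segment. So the path is
  recovered from \<open>\<pi>\<close> by counting closed and opened blocks of these restrictions. Cutting \<open>\<pi>\<close> at the
  block of \<open>i\<close> splits the trace before step \<open>i\<close> into a left and a right part; counting all, closed
  and opened sets in both parts gives the six statistics, and they determine \<open>\<xi>\<^sub>i\<close>.\<close>

section \<open>Label counts and the vertex attached to a trace\<close>

definition opened_count :: "trace \<Rightarrow> nat" where
  "opened_count T = length (filter (\<lambda>x. snd x = Opened) T)"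

definition closed_count :: "trace \<Rightarrow> nat" where
  "closed_count T = length (filter (\<lambda>x. snd x = Closed) T)"

text \<open>The vertex at which the path stands once \<open>psi\<close> has built this trace. It
  makes the path a function of the sequence of traces.\<close>

definition trace_vertex :: "trace \<Rightarrow> vertex" where
  "trace_vertex T = (closed_count T, opened_count T)"

lemma opened_count_simps [simp]:
  "opened_count [] = 0"
  "opened_count (x # T) = (if snd x = Opened then 1 else 0) + opened_count T"
  "opened_count (T @ T') = opened_count T + opened_count T'"
  by (auto simp: opened_count_def)

lemma closed_count_simps [simp]:
  "closed_count [] = 0"
  "closed_count (x # T) = (if snd x = Closed then 1 else 0) + closed_count T"
  "closed_count (T @ T') = closed_count T + closed_count T'"
  by (auto simp: closed_count_def)

lemma closed_plus_opened_count: "closed_count T + opened_count T = length T"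
proof (induction T)
  case (Cons x T)
  then show ?case by (cases "snd x") auto
qed auto

section \<open>Traces on initial segments and their restrictions\<close>

text \<open>The form with \<open>sorted_wrt\<close> decomposes along appended lists, which suits the
  splittings below; since intersection is symmetric, it agrees with the indexed form used for
  ordered partitions.\<close>

definition disjoint_blocks :: "nat set list \<Rightarrow> bool" where
  "disjoint_blocks = sorted_wrt (\<lambda>A B. A \<inter> B = {})"

lemma disjoint_blocks_nth:
  "disjoint_blocks \<pi> \<longleftrightarrow>
     (\<forall>j<length \<pi>. \<forall>j'<length \<pi>. j \<noteq> j' \<longrightarrow> \<pi> ! j \<inter> \<pi> ! j' = {})"
proof
  assume "disjoint_blocks \<pi>"
  then have "\<pi> ! j \<inter> \<pi> ! j' = {}" if "j < j'" "j' < length \<pi>" for j j'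
    using that by (auto simp: disjoint_blocks_def sorted_wrt_iff_nth_less)
  then show "\<forall>j<length \<pi>. \<forall>j'<length \<pi>. j \<noteq> j' \<longrightarrow> \<pi> ! j \<inter> \<pi> ! j' = {}"
    by (metis Int_commute linorder_neqE_nat)
qed (auto simp: disjoint_blocks_def sorted_wrt_iff_nth_less)

definition trace_on :: "nat \<Rightarrow> trace \<Rightarrow> bool" where
  "trace_on i T \<longleftrightarrow> {} \<notin> fst ` set T \<and> disjoint_blocks (map fst T) \<and> \<Union> (fst ` set T) = {1..i}"

text \<open>The state of the construction after step \<open>i\<close>: sets not yet begun vanish,
  and a set that loses elements is still waiting for them, hence is \<open>Opened\<close>. Cutting
  with \<open>{..i}\<close> has the effect of cutting with \<open>{1..i}\<close>, as the sets of a
  trace on an initial segment avoid 0.\<close>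

definition restrict_trace :: "nat \<Rightarrow> trace \<Rightarrow> trace" where
  "restrict_trace i T =
     map (\<lambda>(B, l). (B \<inter> {..i}, if B \<subseteq> {..i} then l else Opened))
       (filter (\<lambda>(B, l). B \<inter> {..i} \<noteq> {}) T)"

lemma restrict_trace_simps [simp]:
  "restrict_trace i [] = []"
  "restrict_trace i (x # T) =
     (if fst x \<inter> {..i} = {} then []
      else [(fst x \<inter> {..i}, if fst x \<subseteq> {..i} then snd x else Opened)]) @ restrict_trace i T"
  "restrict_trace i (T @ T') = restrict_trace i T @ restrict_trace i T'"
  by (auto simp: restrict_trace_def split: prod.splits)

text \<open>A set cut at \<open>j\<close> is already labeled \<open>Opened\<close>, and either
  branch of the second restriction leaves it so, even if its remaining part fits into
  \<open>{..i}\<close>. This allows restrictions to be computed one index at a time.\<close>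

lemma restrict_trace_restrict_trace:
  assumes "i \<le> j"
  shows "restrict_trace i (restrict_trace j T) = restrict_trace i T"
proof (induction T)
  case (Cons x T)
  have "fst x \<inter> {..j} \<inter> {..i} = fst x \<inter> {..i}" using assms by auto
  then show ?case using Cons assms by (auto simp: Int_assoc)
qed simp

lemma restrict_trace_id:
  assumes "\<forall>x\<in>set T. fst x \<noteq> {} \<and> fst x \<subseteq> {..i}"
  shows "restrict_trace i T = T"
  using assms
proof (induction T)
  case (Cons x T)
  then have "fst x \<inter> {..i} = fst x" by auto
  with Cons show ?case by auto
qed simp

lemma restrict_trace_Suc:
  assumes "\<forall>x\<in>set T. Suc i \<notin> fst x"
  shows "restrict_trace (Suc i) T = restrict_trace i T"
  using assms
proof (induction T)
  case (Cons x T)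
  then have "fst x \<inter> {..Suc i} = fst x \<inter> {..i}" and "fst x \<subseteq> {..Suc i} \<longleftrightarrow> fst x \<subseteq> {..i}"
    by (auto simp: atMost_Suc)
  with Cons show ?case by auto
qed simp

section \<open>Steps of the construction as splittings of a trace\<close>

text \<open>North and East steps together: the free label \<open>l\<close> tells them apart. Gaps
  are numbered from 1, whence the \<open>Suc\<close>.\<close>

definition inserts :: "nat \<Rightarrow> nat \<Rightarrow> trace \<Rightarrow> trace \<Rightarrow> bool" where
  "inserts i x T T' \<longleftrightarrow>
     (\<exists>us vs l. T = us @ vs \<and> T' = us @ ({i}, l) # vs \<and> x = Suc (length us))"

text \<open>Null and South-East steps together, again with the label left free. Only the opened sets
  to the left are counted, since \<open>x\<close> numbers opened sets and not positions.\<close>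

definition extends :: "nat \<Rightarrow> nat \<Rightarrow> trace \<Rightarrow> trace \<Rightarrow> bool" where
  "extends i x T T' \<longleftrightarrow>
     (\<exists>us vs A l. T = us @ (A, Opened) # vs \<and> T' = us @ (insert i A, l) # vs
        \<and> x = Suc (opened_count us))"

lemma opened_pos_append:
  assumes "x = Suc (opened_count us)"
  shows "opened_pos (us @ (A, Opened) # vs) x = length us"
proof -
  let ?T = "us @ (A, Opened) # vs"
  let ?P = "\<lambda>j. snd (?T ! j) = Opened"
  \<comment> \<open>The index list is cut at the position of \<open>A\<close>. After filtering,
    exactly \<open>x - 1\<close> indices precede \<open>length us\<close>, so that the lookup at
    \<open>x - 1\<close> returns it.\<close>
  have "[0..<length ?T] = [0..<length us] @ length us # [Suc (length us)..<length ?T]"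
    using upt_add_eq_append[of 0 "length us" "Suc (length vs)"] by (simp add: upt_conv_Cons del: upt_Suc)
  then have split: "filter ?P [0..<length ?T] =
      filter ?P [0..<length us] @ length us # filter ?P [Suc (length us)..<length ?T]"
    by simp
  have "length (filter ?P [0..<length us]) =
      length (filter (\<lambda>j. snd (us ! j) = Opened) [0..<length us])"
    by (intro arg_cong[where f = length] filter_cong) (auto simp: nth_append)
  also have "\<dots> = length (filter (\<lambda>x. snd x = Opened) (map ((!) us) [0..<length us]))"
    by (simp add: filter_map comp_def)
  also have "\<dots> = opened_count us"
    by (simp only: map_nth opened_count_def)
  finally have "length (filter ?P [0..<length us]) = x - 1" using assms by simp
  with split show ?thesis
    unfolding opened_pos_def by (metis nth_append_length)
qed

lemma add_to_opened_append:
  assumes "x = Suc (opened_count us)"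
  shows "add_to_opened x i l (us @ (A, Opened) # vs) = us @ (insert i A, l) # vs"
  by (simp add: add_to_opened_def opened_pos_append[OF assms])

lemma split_at_opened:
  assumes "m < opened_count T"
  obtains us A vs where "T = us @ (A, Opened) # vs" "opened_count us = m"
proof -
  have "\<exists>us A vs. T = us @ (A, Opened) # vs \<and> opened_count us = m"
    using assms
  proof (induction T arbitrary: m)
    case (Cons x T)
    show ?case
    proof (cases "snd x = Opened \<and> m = 0")
      case True
      then have "x # T = [] @ (fst x, Opened) # T" by (cases x) auto
      with True show ?thesis by (metis opened_count_simps(1))
    next
      case False
      \<comment> \<open>An opened head uses up one of the \<open>m\<close> opened sets to be
        skipped; in this case \<open>m\<close> is positive, so the subtraction \<open>m - d\<close>
        is not truncated.\<close>
      define d where "d = (if snd x = Opened then 1 else 0 :: nat)"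
      have "m - d < opened_count T" using Cons.prems False by (auto simp: d_def)
      from Cons.IH[OF this] obtain us A vs
        where "T = us @ (A, Opened) # vs" "opened_count us = m - d" by blast
      then have "x # T = (x # us) @ (A, Opened) # vs" "opened_count (x # us) = m"
        using False by (auto simp: d_def)
      then show ?thesis by blast
    qed
  qed simp
  then show thesis using that by blast
qed

lemmas step_defs = is_north_def is_east_def is_south_east_def is_null_def

text \<open>A trace at vertex \<open>(p, q)\<close> has \<open>p + q\<close> sets and therefore
  \<open>p + q + 1\<close> gaps, so the bound on \<open>x\<close> guarantees that the gap
  exists.\<close>

lemma trace_step_inserts:
  assumes "trace_vertex T = s" "is_north s t \<or> is_east s t"
    and "1 \<le> x" "x \<le> fst s + snd s + 1"
  shows "inserts i x T (trace_step s t x i T)" and "trace_vertex (trace_step s t x i T) = t"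
proof -
  define us vs where "us = take (x - 1) T" and "vs = drop (x - 1) T"
  have T: "T = us @ vs" by (simp add: us_def vs_def)
  have "x - 1 \<le> length T"
    using assms closed_plus_opened_count[of T] by (auto simp: trace_vertex_def)
  then have x: "x = Suc (length us)" using \<open>1 \<le> x\<close> by (simp add: us_def)
  define l where "l = (if is_north s t then Opened else Closed)"
  have step: "trace_step s t x i T = us @ ({i}, l) # vs"
    using assms(2) by (auto simp: trace_step_def insert_gap_def us_def vs_def l_def)
  show "inserts i x T (trace_step s t x i T)"
    using T step x unfolding inserts_def by blast
  show "trace_vertex (trace_step s t x i T) = t"
    using assms(1,2) unfolding step by (auto simp: T trace_vertex_def l_def step_defs)
qed

lemma trace_step_extends:
  assumes "trace_vertex T = s" "is_null s t \<or> is_south_east s t"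
    and "1 \<le> x" "x \<le> snd s"
  shows "extends i x T (trace_step s t x i T)" and "trace_vertex (trace_step s t x i T) = t"
proof -
  have "x - 1 < opened_count T" using assms by (auto simp: trace_vertex_def)
  then obtain us A vs where T: "T = us @ (A, Opened) # vs" and "opened_count us = x - 1"
    by (rule split_at_opened)
  then have x: "x = Suc (opened_count us)" using \<open>1 \<le> x\<close> by simp
  define l where "l = (if is_null s t then Opened else Closed)"
  \<comment> \<open>The guard \<open>snd s > 0\<close> matters here: it keeps a South-East step from
    coinciding with an East step, which \<open>trace_step\<close> tests for earlier.\<close>
  have step: "trace_step s t x i T = us @ (insert i A, l) # vs"
    using assms(2) unfolding T
    by (cases s) (auto simp: trace_step_def add_to_opened_append[OF x] l_def step_defs)
  show "extends i x T (trace_step s t x i T)"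
    using T step x unfolding extends_def by blast
  show "trace_vertex (trace_step s t x i T) = t"
    using assms(1,2) unfolding step by (auto simp: T trace_vertex_def l_def step_defs)
qed

text \<open>Converse direction, used for surjectivity: the change of the label counts reveals the
  type of the step, and the splitting reveals an admissible weight.\<close>

lemma inserts_trace_step:
  assumes "inserts i x T T'"
  defines "s \<equiv> trace_vertex T" and "t \<equiv> trace_vertex T'"
  shows "is_north s t \<or> is_east s t" "1 \<le> x" "x \<le> fst s + snd s + 1"
    and "T' = trace_step s t x i T"
proof -
  obtain us vs l where T: "T = us @ vs" "T' = us @ ({i}, l) # vs" "x = Suc (length us)"
    using assms unfolding inserts_def by blast
  show "is_north s t \<or> is_east s t" "T' = trace_step s t x i T"
    by (cases l; simp add: T s_def t_def trace_vertex_def step_defs trace_step_def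
        insert_gap_def)+
  show "1 \<le> x" "x \<le> fst s + snd s + 1"
    using T closed_plus_opened_count[of T] by (auto simp: s_def trace_vertex_def)
qed

lemma extends_trace_step:
  assumes "extends i x T T'"
  defines "s \<equiv> trace_vertex T" and "t \<equiv> trace_vertex T'"
  shows "is_null s t \<or> is_south_east s t" "1 \<le> x" "x \<le> snd s"
    and "T' = trace_step s t x i T"
proof -
  obtain us vs A l where T: "T = us @ (A, Opened) # vs" "T' = us @ (insert i A, l) # vs"
    and x: "x = Suc (opened_count us)"
    using assms unfolding extends_def by blast
  show "is_null s t \<or> is_south_east s t" "T' = trace_step s t x i T"
    by (cases l; simp add: T s_def t_def trace_vertex_def step_defs trace_step_def
        add_to_opened_append[OF x])+
  show "1 \<le> x" "x \<le> snd s"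
    using T x by (auto simp: s_def trace_vertex_def)
qed

section \<open>Restriction undoes a step\<close>

lemma trace_on_subset:
  assumes "trace_on i T" "x \<in> set T"
  shows "fst x \<noteq> {}" "fst x \<subseteq> {1..i}"
  using assms unfolding trace_on_def by (metis imageI, blast)

text \<open>All old sets lie in \<open>{1..i}\<close> and survive restriction unchanged with their
  labels, while the new singleton misses \<open>{..i}\<close> and disappears.\<close>

lemma trace_on_inserts:
  assumes "trace_on i T" "inserts (Suc i) x T T'"
  shows "trace_on (Suc i) T'" "restrict_trace i T' = T"
proof -
  obtain us vs l where T: "T = us @ vs" "T' = us @ ({Suc i}, l) # vs"
    using assms(2) unfolding inserts_def by blast
  have sub: "fst x \<noteq> {} \<and> fst x \<subseteq> {1..i}" if "x \<in> set us \<union> set vs" for x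
    using trace_on_subset[OF assms(1), of x] that T by auto
  have U: "\<Union> (fst ` set T) = {1..i}" and D: "disjoint_blocks (map fst T)"
    using assms(1) by (auto simp: trace_on_def)
  have new: "Suc i \<notin> fst x" if "x \<in> set us \<union> set vs" for x
    using sub[OF that] by auto
  have "\<Union> (fst ` set T') = insert (Suc i) {1..i}" unfolding U[symmetric] T by auto
  moreover have "disjoint_blocks (map fst T')"
    using D new unfolding T disjoint_blocks_def by (auto simp: sorted_wrt_append)
  moreover have "{} \<notin> fst ` set T'" using sub T by auto
  ultimately show "trace_on (Suc i) T'" by (auto simp: trace_on_def)
  have "restrict_trace i us = us" "restrict_trace i vs = vs"
    by (rule restrict_trace_id, use sub in force)+
  then show "restrict_trace i T' = T" by (simp add: T)
qed

text \<open>As for an insertion, but the enlarged set is cut back to \<open>A\<close>. Whatever its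
  new label \<open>l\<close>, the cut resets it to \<open>Opened\<close>, which is the label it had
  before the step.\<close>

lemma trace_on_extends:
  assumes "trace_on i T" "extends (Suc i) x T T'"
  shows "trace_on (Suc i) T'" "restrict_trace i T' = T"
proof -
  obtain us vs A l where T: "T = us @ (A, Opened) # vs" "T' = us @ (insert (Suc i) A, l) # vs"
    using assms(2) unfolding extends_def by blast
  have sub: "fst x \<noteq> {} \<and> fst x \<subseteq> {1..i}" if "x \<in> set us \<union> set vs" for x
    using trace_on_subset[OF assms(1), of x] that T by auto
  have A: "A \<noteq> {}" "A \<subseteq> {1..i}" using trace_on_subset[OF assms(1), of "(A, Opened)"] T by auto
  have U: "\<Union> (fst ` set T) = {1..i}" and D: "disjoint_blocks (map fst T)"
    using assms(1) by (auto simp: trace_on_def)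
  have new: "Suc i \<notin> fst x" if "x \<in> set us \<union> set vs" for x
    using sub[OF that] by auto
  have "\<Union> (fst ` set T') = insert (Suc i) {1..i}" unfolding U[symmetric] T by auto
  moreover have "disjoint_blocks (map fst T')"
    using D new unfolding T disjoint_blocks_def by (auto simp: sorted_wrt_append)
  moreover have "{} \<notin> fst ` set T'" using sub T by auto
  ultimately show "trace_on (Suc i) T'" by (auto simp: trace_on_def)
  have "restrict_trace i us = us" "restrict_trace i vs = vs"
    by (rule restrict_trace_id, use sub in force)+
  moreover have "insert (Suc i) A \<inter> {..i} = A" using A by auto
  ultimately show "restrict_trace i T' = T" using A by (simp add: T)
qed

section \<open>The six statistics as counts in restricted partitions\<close>

text \<open>The final trace behind a partition: a path ending at \<open>(k, 0)\<close> leaves no set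
  opened.\<close>

definition closed_trace :: "nat set list \<Rightarrow> trace" where
  "closed_trace \<pi> = map (\<lambda>B. (B, Closed)) \<pi>"

lemma closed_trace_simps [simp]:
  "closed_trace [] = []"
  "closed_trace (B # \<pi>) = (B, Closed) # closed_trace \<pi>"
  "closed_trace (\<pi> @ \<pi>') = closed_trace \<pi> @ closed_trace \<pi>'"
  "length (closed_trace \<pi>) = length \<pi>"
  "map fst (closed_trace \<pi>) = \<pi>"
  "opened_count (closed_trace \<pi>) = 0"
  "closed_count (closed_trace \<pi>) = length \<pi>"
  by (auto simp: closed_trace_def opened_count_def closed_count_def comp_def)

text \<open>Because \<open>i\<close> lies in none of the blocks, comparisons of \<open>i\<close>
  with \<open>Min C\<close> and \<open>Max C\<close> are strict: a block meets \<open>{..i}\<close>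
  iff \<open>Min C < i\<close> and is contained in it iff \<open>Max C < i\<close>.\<close>

lemma restrict_closed_trace_counts:
  assumes "\<forall>C\<in>set \<pi>. finite C \<and> C \<noteq> {} \<and> i \<notin> C"
  shows "length (restrict_trace i (closed_trace \<pi>)) = length (filter (\<lambda>C. Min C < i) \<pi>)"
    and "closed_count (restrict_trace i (closed_trace \<pi>)) = length (filter (\<lambda>C. Max C < i) \<pi>)"
    and "opened_count (restrict_trace i (closed_trace \<pi>)) =
           length (filter (\<lambda>C. Min C < i \<and> i < Max C) \<pi>)"
proof -
  have "length (restrict_trace i (closed_trace \<pi>)) = length (filter (\<lambda>C. Min C < i) \<pi>) \<and>
    closed_count (restrict_trace i (closed_trace \<pi>)) = length (filter (\<lambda>C. Max C < i) \<pi>) \<and>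
    opened_count (restrict_trace i (closed_trace \<pi>)) =
           length (filter (\<lambda>C. Min C < i \<and> i < Max C) \<pi>)"
    using assms
  proof (induction \<pi>)
    case (Cons C \<pi>)
    then have C: "finite C" "C \<noteq> {}" "i \<notin> C" by auto
    have min: "C \<inter> {..i} = {} \<longleftrightarrow> \<not> Min C < i"
      using C Min_in[of C] Min_le[of C] by (metis Int_iff atMost_iff disjoint_iff
          leD leI le_neq_trans order_trans less_imp_le)
    have max: "C \<subseteq> {..i} \<longleftrightarrow> Max C < i" "\<not> C \<subseteq> {..i} \<longleftrightarrow> i < Max C"
      using C Max_in[of C] Max_ge[of C]
      by (metis atMost_iff le_neq_trans less_imp_le order_trans subsetD subsetI,
          metis atMost_iff leD leI le_neq_trans less_imp_le order_trans subsetD subsetI)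
    have mm: "Min C \<le> Max C" using C by simp
    from Cons have IH: "length (restrict_trace i (closed_trace \<pi>)) = length (filter (\<lambda>C. Min C < i) \<pi>)"
      "closed_count (restrict_trace i (closed_trace \<pi>)) = length (filter (\<lambda>C. Max C < i) \<pi>)"
      "opened_count (restrict_trace i (closed_trace \<pi>)) =
           length (filter (\<lambda>C. Min C < i \<and> i < Max C) \<pi>)" by auto
    show ?case
      using mm max by (auto simp: min IH)
  qed simp
  then show "length (restrict_trace i (closed_trace \<pi>)) = length (filter (\<lambda>C. Min C < i) \<pi>)"
    and "closed_count (restrict_trace i (closed_trace \<pi>)) = length (filter (\<lambda>C. Max C < i) \<pi>)"
    and "opened_count (restrict_trace i (closed_trace \<pi>)) =
           length (filter (\<lambda>C. Min C < i \<and> i < Max C) \<pi>)"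
    by auto
qed

lemma block_eq:
  assumes "disjoint_blocks \<pi>" "b < length \<pi>" "j \<in> \<pi> ! b"
  shows "block \<pi> j = b"
  unfolding block_def
  using assms by (intro the_equality) (auto simp: disjoint_blocks_nth)

text \<open>Choosing one element \<open>h C\<close> from each of the disjoint blocks is injective
  with inverse \<open>block\<close>. With \<open>h\<close> equal to \<open>Min\<close> or
  \<open>Max\<close>, counting openers or closers becomes counting blocks.\<close>

lemma card_block_representatives:
  assumes "disjoint_blocks \<pi>" "\<forall>C\<in>set \<pi>. h C \<in> C"
  shows "card {j \<in> h ` set \<pi>. j < i \<and> Q (block \<pi> j)} =
         card {b. b < length \<pi> \<and> Q b \<and> h (\<pi> ! b) < i}"
proof -
  have block: "block \<pi> (h (\<pi> ! b)) = b" if "b < length \<pi>" for b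
    using assms that by (intro block_eq) auto
  have "{j \<in> h ` set \<pi>. j < i \<and> Q (block \<pi> j)} =
      (\<lambda>b. h (\<pi> ! b)) ` {b. b < length \<pi> \<and> Q b \<and> h (\<pi> ! b) < i}"
    using block by (force simp: set_conv_nth)
  moreover have "inj_on (\<lambda>b. h (\<pi> ! b)) {b. b < length \<pi> \<and> Q b \<and> h (\<pi> ! b) < i}"
    by (rule inj_on_inverseI[where g = "block \<pi>"]) (use block in auto)
  ultimately show ?thesis by (simp add: card_image)
qed

lemma card_left_blocks:
  "card {b. b < length (L @ B # M) \<and> b < length L \<and> P ((L @ B # M) ! b)} = length (filter P L)"
  unfolding length_filter_conv_card
  by (rule arg_cong[where f = card]) (auto simp: nth_append)

lemma card_right_blocks:
  "card {b. b < length (L @ B # M) \<and> length L < b \<and> P ((L @ B # M) ! b)} = length (filter P M)"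
proof -
  have "{b. b < length (L @ B # M) \<and> length L < b \<and> P ((L @ B # M) ! b)} =
      (\<lambda>b. Suc (length L + b)) ` {b. b < length M \<and> P (M ! b)}"
  proof (intro equalityI subsetI)
    fix b assume b: "b \<in> {b. b < length (L @ B # M) \<and> length L < b \<and> P ((L @ B # M) ! b)}"
    then obtain c where c: "b = Suc (length L + c)" using less_imp_Suc_add by auto
    then show "b \<in> (\<lambda>b. Suc (length L + b)) ` {b. b < length M \<and> P (M ! b)}"
      using b by (auto simp: nth_append)
  qed (auto simp: nth_append)
  then show ?thesis
    unfolding length_filter_conv_card by (simp add: card_image inj_on_def)
qed

text \<open>Blocks left of \<open>i\<close> are those in \<open>L\<close>, blocks right of it those
  in \<open>M\<close>. As \<open>i\<close> occurs in neither, restricting them at \<open>i\<close>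
  gives the same as restricting at the preceding index, so these counts also describe the trace
  before step \<open>i\<close>.\<close>

lemma statistics_eq_counts:
  assumes "disjoint_blocks \<pi>" "\<forall>C\<in>set \<pi>. finite C \<and> C \<noteq> {}"
    and \<pi>: "\<pi> = L @ B # M" and "i \<in> B"
  defines "us \<equiv> restrict_trace i (closed_trace L)" and "vs \<equiv> restrict_trace i (closed_trace M)"
  shows "los \<pi> i = length us" "ros \<pi> i = length vs"
    "lcs \<pi> i = closed_count us" "rcs \<pi> i = closed_count vs"
    "lsb \<pi> i = opened_count us" "rsb \<pi> i = opened_count vs"
proof -
  have blk: "block \<pi> i = length L" by (rule block_eq) (use assms in auto)
  have Min: "\<forall>C\<in>set \<pi>. Min C \<in> C" and Max: "\<forall>C\<in>set \<pi>. Max C \<in> C" using assms by auto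
  have L: "\<forall>C\<in>set L. finite C \<and> C \<noteq> {} \<and> i \<notin> C" and M: "\<forall>C\<in>set M. finite C \<and> C \<noteq> {} \<and> i \<notin> C"
    using assms by (auto simp: disjoint_blocks_def sorted_wrt_append)
  note counts = restrict_closed_trace_counts[OF L] restrict_closed_trace_counts[OF M]
  show "los \<pi> i = length us" "ros \<pi> i = length vs"
    unfolding los_def ros_def openers_def us_def vs_def counts blk
      card_block_representatives[OF assms(1) Min, where Q = "\<lambda>b. b < length L"]
      card_block_representatives[OF assms(1) Min, where Q = "\<lambda>b. length L < b"]
    unfolding \<pi> by (rule card_left_blocks card_right_blocks)+
  show "lcs \<pi> i = closed_count us" "rcs \<pi> i = closed_count vs"
    unfolding lcs_def rcs_def closers_def us_def vs_def counts blk
      card_block_representatives[OF assms(1) Max, where Q = "\<lambda>b. b < length L"]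
      card_block_representatives[OF assms(1) Max, where Q = "\<lambda>b. length L < b"]
    unfolding \<pi> by (rule card_left_blocks card_right_blocks)+
  show "lsb \<pi> i = opened_count us" "rsb \<pi> i = opened_count vs"
    unfolding lsb_def rsb_def us_def vs_def counts blk
    unfolding \<pi> by (rule card_left_blocks card_right_blocks)+
qed

section \<open>Uniqueness of splittings, and ordered partitions as closed traces\<close>

text \<open>Both splittings cut at the first element satisfying \<open>P\<close>. It serves to
  identify the splitting given by a step with the one given by the block of the new element.\<close>

lemma split_unique:
  assumes "us @ y # vs = us' @ y' # vs'"
    and "P y" "P y'" "\<forall>x\<in>set us \<union> set us'. \<not> P x"
  shows "us = us' \<and> y = y' \<and> vs = vs'"
proof -
  have "takeWhile (\<lambda>x. \<not> P x) (us @ y # vs) = us" "takeWhile (\<lambda>x. \<not> P x) (us' @ y' # vs') = us'"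
    using assms(2-4) by simp_all
  then have "us = us'" using assms(1) by metis
  then show ?thesis using assms(1) by simp
qed

lemma closed_trace_map_fst:
  assumes "opened_count T = 0"
  shows "closed_trace (map fst T) = T"
  using assms
proof (induction T)
  case (Cons x T)
  then show ?case by (cases x; cases "snd x") auto
qed simp

lemma trace_on_closed_trace:
  "trace_on n (closed_trace \<pi>) \<longleftrightarrow> \<pi> \<in> ordered_partitions n (length \<pi>)"
proof -
  have "fst ` set (closed_trace \<pi>) = set \<pi>" by (force simp: closed_trace_def)
  then show ?thesis
    unfolding trace_on_def ordered_partitions_def
    by (auto simp: disjoint_blocks_nth in_set_conv_nth)
qed

lemma ordered_partitionD:
  assumes "\<pi> \<in> ordered_partitions n k"
  shows "disjoint_blocks \<pi>" "\<forall>C\<in>set \<pi>. finite C \<and> C \<noteq> {} \<and> C \<subseteq> {1..n}"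
    and "i \<in> {1..n} \<Longrightarrow> \<exists>L B M. \<pi> = L @ B # M \<and> i \<in> B \<and> (\<forall>C\<in>set L \<union> set M. i \<notin> C)"
proof -
  show D: "disjoint_blocks \<pi>"
    using assms by (auto simp: ordered_partitions_def disjoint_blocks_nth)
  have U: "\<Union> (set \<pi>) = {1..n}" and N: "\<forall>C\<in>set \<pi>. C \<noteq> {}"
    using assms by (auto simp: ordered_partitions_def in_set_conv_nth)
  have "C \<subseteq> {1..n}" if "C \<in> set \<pi>" for C using U that by blast
  then show "\<forall>C\<in>set \<pi>. finite C \<and> C \<noteq> {} \<and> C \<subseteq> {1..n}"
    using N by (meson finite_atLeastAtMost finite_subset)
  assume "i \<in> {1..n}"
  then obtain B where B: "B \<in> set \<pi>" "i \<in> B" using U by blast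
  then obtain L M where \<pi>: "\<pi> = L @ B # M" using split_list by metis
  have "\<forall>C\<in>set L \<union> set M. i \<notin> C"
    using D B unfolding \<pi> disjoint_blocks_def by (auto simp: sorted_wrt_append)
  with B \<pi> show "\<exists>L B M. \<pi> = L @ B # M \<and> i \<in> B \<and> (\<forall>C\<in>set L \<union> set M. i \<notin> C)" by blast
qed

section \<open>From path diagrams to ordered partitions\<close>

text \<open>The bounds on the weights in a path diagram are the hypotheses under which a step is a
  genuine insertion or extension. The conclusions provide the invariant for the induction along the
  path and the means to go back.\<close>

lemma path_diagram_step:
  assumes "(\<omega>, \<xi>) \<in> path_diagrams n k" "i < n"
    and "trace_on i T" "trace_vertex T = \<omega> ! i"
  defines "T' \<equiv> trace_step (\<omega> ! i) (\<omega> ! Suc i) (\<xi> ! i) (Suc i) T"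
  shows "trace_vertex T' = \<omega> ! Suc i" "trace_on (Suc i) T'" "restrict_trace i T' = T"
    and "is_north (\<omega> ! i) (\<omega> ! Suc i) \<or> is_east (\<omega> ! i) (\<omega> ! Suc i) \<Longrightarrow>
           inserts (Suc i) (\<xi> ! i) T T'"
    and "is_null (\<omega> ! i) (\<omega> ! Suc i) \<or> is_south_east (\<omega> ! i) (\<omega> ! Suc i) \<Longrightarrow>
           extends (Suc i) (\<xi> ! i) T T'"
proof -
  let ?s = "\<omega> ! i" and ?t = "\<omega> ! Suc i"
  have i: "Suc i \<in> {1..n}" using assms(2) by auto
  have edge: "(?s, ?t) \<in> D_edges k"
    using assms(1) i unfolding path_diagrams_def paths_def
    by (auto dest!: bspec[where x = "Suc i"])
  have "\<forall>p q. ?s = (p, q) \<longrightarrow>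
      (is_null (p, q) ?t \<or> is_south_east (p, q) ?t \<longrightarrow> 1 \<le> \<xi> ! i \<and> \<xi> ! i \<le> q)
    \<and> (is_north (p, q) ?t \<or> is_east (p, q) ?t \<longrightarrow> 1 \<le> \<xi> ! i \<and> \<xi> ! i \<le> p + q + 1)"
    using assms(1) i unfolding path_diagrams_def
    by (auto dest!: bspec[where x = "Suc i"])
  then have range:
    "is_null ?s ?t \<or> is_south_east ?s ?t \<Longrightarrow> 1 \<le> \<xi> ! i \<and> \<xi> ! i \<le> snd ?s"
    "is_north ?s ?t \<or> is_east ?s ?t \<Longrightarrow> 1 \<le> \<xi> ! i \<and> \<xi> ! i \<le> fst ?s + snd ?s + 1"
    by (metis prod.collapse)+
  show ins: "inserts (Suc i) (\<xi> ! i) T T'" if "is_north ?s ?t \<or> is_east ?s ?t"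
    using trace_step_inserts(1)[OF assms(4) that] range(2)[OF that] by (simp add: T'_def)
  show ext: "extends (Suc i) (\<xi> ! i) T T'" if "is_null ?s ?t \<or> is_south_east ?s ?t"
    using trace_step_extends(1)[OF assms(4) that] range(1)[OF that] by (simp add: T'_def)
  have cases: "(is_north ?s ?t \<or> is_east ?s ?t) \<or> (is_null ?s ?t \<or> is_south_east ?s ?t)"
    using edge by (auto simp: D_edges_def)
  show "trace_vertex T' = ?t"
    using cases trace_step_inserts(2)[OF assms(4)] trace_step_extends(2)[OF assms(4)] range
    unfolding T'_def by blast
  show "trace_on (Suc i) T'" "restrict_trace i T' = T"
    using cases ins ext trace_on_inserts[OF assms(3)] trace_on_extends[OF assms(3)] by blast+
qed

lemma trace_of_path_diagram:
  assumes "(\<omega>, \<xi>) \<in> path_diagrams n k" "i \<le> n"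
  shows "trace_vertex (trace_of \<omega> \<xi> i) = \<omega> ! i" "trace_on i (trace_of \<omega> \<xi> i)"
proof -
  have "trace_vertex (trace_of \<omega> \<xi> i) = \<omega> ! i \<and> trace_on i (trace_of \<omega> \<xi> i)"
    using assms(2)
  proof (induction i)
    case 0
    have "\<omega> ! 0 = (0, 0)" using assms(1) by (auto simp: path_diagrams_def paths_def)
    then show ?case by (auto simp: trace_vertex_def trace_on_def disjoint_blocks_def)
  next
    case (Suc i)
    then show ?case using path_diagram_step[OF assms(1), of i "trace_of \<omega> \<xi> i"] by simp
  qed
  then show "trace_vertex (trace_of \<omega> \<xi> i) = \<omega> ! i" "trace_on i (trace_of \<omega> \<xi> i)" by auto
qed

text \<open>The last vertex \<open>(k, 0)\<close> forces exactly \<open>k\<close> sets, all closed,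
  so the final trace and the partition determine each other. Each earlier trace is then a
  restriction of the partition.\<close>

lemma psi_path_diagram:
  assumes "(\<omega>, \<xi>) \<in> path_diagrams n k"
  defines "\<pi> \<equiv> psi (\<omega>, \<xi>)"
  shows "\<pi> \<in> ordered_partitions n k"
    and "i \<le> n \<Longrightarrow> trace_of \<omega> \<xi> i = restrict_trace i (closed_trace \<pi>)"
proof -
  let ?T = "trace_of \<omega> \<xi>"
  have len: "length \<xi> = n" and "\<omega> ! n = (k, 0)"
    using assms by (auto simp: path_diagrams_def paths_def)
  then have count: "closed_count (?T n) = k" "opened_count (?T n) = 0"
    using trace_of_path_diagram(1)[OF assms(1), of n] by (auto simp: trace_vertex_def)
  have \<pi>: "\<pi> = map fst (?T n)" by (simp add: \<pi>_def psi_def len)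
  have T: "?T n = closed_trace \<pi>" unfolding \<pi> using closed_trace_map_fst[OF count(2)] by simp
  then have "length \<pi> = k" using count by simp
  then show "\<pi> \<in> ordered_partitions n k"
    using trace_of_path_diagram(2)[OF assms(1), of n] T trace_on_closed_trace by simp
  assume "i \<le> n"
  then have "?T i = restrict_trace i (?T n)"
  \<comment> \<open>Descent from \<open>n\<close> to \<open>i\<close>: each step is undone by
    restriction, and nested restrictions collapse into one.\<close>
  proof (induction rule: inc_induct)
    case base
    show ?case
      using trace_on_subset[OF trace_of_path_diagram(2)[OF assms(1) order_refl]]
      by (intro restrict_trace_id[symmetric]) fastforce
  next
    case (step i)
    have "?T i = restrict_trace i (?T (Suc i))"
      using path_diagram_step(3)[OF assms(1), of i "?T i"] step(2)
        trace_of_path_diagram[OF assms(1), of i] by simp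
    then show ?case by (metis step.IH restrict_trace_restrict_trace le_SucI order_refl)
  qed
  then show "?T i = restrict_trace i (closed_trace \<pi>)" by (simp add: T)
qed

section \<open>Element types, statistics and injectivity\<close>

lemma block_element_type:
  assumes "B \<in> set \<pi>" "finite B" "i \<in> B"
  shows "(\<forall>j\<in>B. i \<le> j) \<Longrightarrow> i \<in> strict_openers \<pi> \<union> singletons \<pi>"
    and "\<exists>j\<in>B. j < i \<Longrightarrow> i \<in> transients \<pi> \<union> strict_closers \<pi>"
proof -
  have pos: "card B \<noteq> 0" using assms by auto
  show "i \<in> strict_openers \<pi> \<union> singletons \<pi>" if "\<forall>j\<in>B. i \<le> j"
  proof (cases "card B = 1")
    case True
    then have "B = {i}" using assms(3) by (metis card_1_singletonE singletonD)
    then show ?thesis using assms by (auto simp: singletons_def)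
  next
    case False
    moreover have "i = Min B" using that assms by (metis Min_eqI)
    ultimately show ?thesis using assms pos by (force simp: strict_openers_def)
  qed
  show "i \<in> transients \<pi> \<union> strict_closers \<pi>" if less: "\<exists>j\<in>B. j < i"
  proof -
    obtain j where j: "j \<in> B" "j < i" using less by blast
    then have "card {j, i} \<le> card B" using assms by (intro card_mono) auto
    then have "2 \<le> card B" using j by simp
    moreover have "i \<noteq> Min B" using j assms by (metis Min_le leD)
    ultimately show ?thesis
      using assms by (auto simp: transients_def strict_closers_def)
  qed
qed

text \<open>The trace after the step is split in two ways, at the restricted block of the new
  element and at the place where the step acts. The new element occurs in no set to the left in
  either splitting, so they agree, and counting labels on both sides yields all claims. The
  equations are additive to avoid truncated subtraction.\<close>

lemma path_diagram_statistics:
  assumes "(\<omega>, \<xi>) \<in> path_diagrams n k" "i < n" "\<omega> ! i = (p, q)"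
  defines "\<pi> \<equiv> psi (\<omega>, \<xi>)"
  shows "is_north (p, q) (\<omega> ! Suc i) \<or> is_east (p, q) (\<omega> ! Suc i) \<Longrightarrow>
      Suc i \<in> strict_openers \<pi> \<union> singletons \<pi>
    \<and> lcs \<pi> (Suc i) + rcs \<pi> (Suc i) = p \<and> lsb \<pi> (Suc i) + rsb \<pi> (Suc i) = q
    \<and> Suc (los \<pi> (Suc i)) = \<xi> ! i \<and> ros \<pi> (Suc i) + \<xi> ! i = p + q + 1"
    (is "?north \<Longrightarrow> ?stat_opener")
    and "is_south_east (p, q) (\<omega> ! Suc i) \<or> is_null (p, q) (\<omega> ! Suc i) \<Longrightarrow>
      Suc i \<in> transients \<pi> \<union> strict_closers \<pi>
    \<and> lcs \<pi> (Suc i) + rcs \<pi> (Suc i) = p \<and> Suc (lsb \<pi> (Suc i) + rsb \<pi> (Suc i)) = q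
    \<and> Suc (lsb \<pi> (Suc i)) = \<xi> ! i \<and> rsb \<pi> (Suc i) + \<xi> ! i = q"
    (is "?null \<Longrightarrow> ?stat_closer")
proof -
  let ?i = "Suc i"
  define T where "T = trace_of \<omega> \<xi> i"
  define T' where "T' = trace_of \<omega> \<xi> ?i"
  note OP = ordered_partitionD[OF psi_path_diagram(1)[OF assms(1)], folded \<pi>_def]
  obtain L B M where \<pi>: "\<pi> = L @ B # M" and B: "?i \<in> B"
    and LM: "\<forall>C\<in>set L \<union> set M. ?i \<notin> C"
    using OP(3)[of ?i] assms(2) by auto
  define us vs where "us = restrict_trace ?i (closed_trace L)"
    and "vs = restrict_trace ?i (closed_trace M)"
  obtain l where T'_split: "T' = us @ (B \<inter> {..?i}, l) # vs"
  proof
    show "T' = us @ (B \<inter> {..?i}, if B \<subseteq> {..?i} then Closed else Opened) # vs"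
      using psi_path_diagram(2)[OF assms(1), of ?i] assms(2) B
      by (auto simp: T'_def \<pi>_def[symmetric] \<pi> us_def vs_def)
  qed
  have fin: "\<forall>C\<in>set \<pi>. finite C \<and> C \<noteq> {}" using OP(2) by blast
  note stats = statistics_eq_counts[OF OP(1) fin \<pi> B, folded us_def vs_def]
  have us_new: "\<forall>x\<in>set us. ?i \<notin> fst x"
    using LM by (auto simp: us_def restrict_trace_def closed_trace_def)
  have T_on: "trace_on i T" and T_vertex: "trace_vertex T = (p, q)"
    using trace_of_path_diagram[OF assms(1), of i] assms(2,3) by (auto simp: T_def)
  have T_new: "\<forall>x\<in>set T. ?i \<notin> fst x" using trace_on_subset(2)[OF T_on] by fastforce
  have step: "?north \<Longrightarrow> inserts ?i (\<xi> ! i) T T'" "?null \<Longrightarrow> extends ?i (\<xi> ! i) T T'"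
    using path_diagram_step(4,5)[OF assms(1,2) T_on] T_vertex assms(3)
    by (auto simp: T_def T'_def)
  have pq: "p = closed_count T" "q = opened_count T" using T_vertex by (auto simp: trace_vertex_def)
  have B_set: "B \<in> set \<pi>" "finite B" using OP(2) \<pi> by auto
  show ?stat_opener if north: ?north
  proof -
    obtain us' vs' l' where split: "T = us' @ vs'" "T' = us' @ ({?i}, l') # vs'"
      and x: "\<xi> ! i = Suc (length us')"
      using step(1)[OF north] unfolding inserts_def by blast
    have "us = us' \<and> (B \<inter> {..?i}, l) = ({?i}, l') \<and> vs = vs'"
    proof (rule split_unique[where P = "\<lambda>x. ?i \<in> fst x"])
      show "us @ (B \<inter> {..?i}, l) # vs = us' @ ({?i}, l') # vs'" using T'_split split by simp
      show "\<forall>x\<in>set us \<union> set us'. ?i \<notin> fst x" using us_new T_new split by auto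
    qed (use B in auto)
    then have eq: "us' = us" "vs' = vs" "B \<inter> {..?i} = {?i}" by auto
    have "\<forall>j\<in>B. ?i \<le> j"
    proof (rule ballI, rule ccontr)
      fix j assume "j \<in> B" "\<not> ?i \<le> j"
      then have "j \<in> B \<inter> {..?i}" by simp
      with eq(3) \<open>\<not> ?i \<le> j\<close> show False by auto
    qed
    then have "?i \<in> strict_openers \<pi> \<union> singletons \<pi>"
      using block_element_type(1)[OF B_set B] by blast
    \<comment> \<open>Here \<open>los\<close> and \<open>ros\<close> count all sets on a side,
      whereas \<open>p\<close> and \<open>q\<close> count by label; this links the two.\<close>
    moreover have "length us = closed_count us + opened_count us"
      "length vs = closed_count vs + opened_count vs"
      by (simp_all add: closed_plus_opened_count)
    ultimately show ?thesis by (simp add: stats pq split(1) x eq)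
  qed
  show ?stat_closer if null: ?null
  proof -
    obtain us' vs' A l' where split: "T = us' @ (A, Opened) # vs'" "T' = us' @ (insert ?i A, l') # vs'"
      and x: "\<xi> ! i = Suc (opened_count us')"
      using step(2)[OF null] unfolding extends_def by blast
    have "us = us' \<and> (B \<inter> {..?i}, l) = (insert ?i A, l') \<and> vs = vs'"
    proof (rule split_unique[where P = "\<lambda>x. ?i \<in> fst x"])
      show "us @ (B \<inter> {..?i}, l) # vs = us' @ (insert ?i A, l') # vs'" using T'_split split by simp
      show "\<forall>x\<in>set us \<union> set us'. ?i \<notin> fst x" using us_new T_new split by auto
    qed (use B in auto)
    then have eq: "us' = us" "vs' = vs" "B \<inter> {..?i} = insert ?i A" by auto
    have "A \<noteq> {}" "A \<subseteq> {1..i}" using trace_on_subset[OF T_on, of "(A, Opened)"] split by auto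
    then obtain j where "j \<in> A" "j < ?i" by force
    moreover have "A \<subseteq> B" using eq(3) by blast
    ultimately have "\<exists>j\<in>B. j < ?i" by blast
    then have "?i \<in> transients \<pi> \<union> strict_closers \<pi>"
      using block_element_type(2)[OF B_set B] by blast
    \<comment> \<open>The set \<open>A\<close> being extended is itself one of the \<open>q\<close>
      opened sets but lies on neither side, which accounts for the \<open>Suc\<close>.\<close>
    then show ?thesis by (simp add: stats pq split(1) x eq)
  qed
qed

text \<open>The vertices are label counts of restrictions of the partition; once the path is known,
  each weight is \<open>Suc\<close> of \<open>los\<close> or of \<open>lsb\<close>, depending on the
  type of the step.\<close>

lemma inj_on_psi: "inj_on psi (path_diagrams n k)"
proof (rule inj_onI, clarify)
  fix \<omega> \<xi> \<omega>' \<xi>'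
  assume D: "(\<omega>, \<xi>) \<in> path_diagrams n k" and D': "(\<omega>', \<xi>') \<in> path_diagrams n k"
    and eq: "psi (\<omega>, \<xi>) = psi (\<omega>', \<xi>')"
  have len: "length \<omega> = n + 1" "length \<omega>' = n + 1" "length \<xi> = n" "length \<xi>' = n"
    using D D' by (auto simp: path_diagrams_def paths_def)
  have nth: "\<omega> ! i = \<omega>' ! i" if "i \<le> n" for i
    using trace_of_path_diagram(1)[OF D that] trace_of_path_diagram(1)[OF D' that]
      psi_path_diagram(2)[OF D that] psi_path_diagram(2)[OF D' that] eq by metis
  then have \<omega>: "\<omega> = \<omega>'" using len by (intro nth_equalityI) auto
  moreover have "\<xi> ! i = \<xi>' ! i" if "i < n" for i
  proof -
    obtain p q where s: "\<omega> ! i = (p, q)" by fastforce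
    have "(\<omega> ! i, \<omega> ! Suc i) \<in> D_edges k"
      using D that unfolding path_diagrams_def paths_def
      by (auto dest!: bspec[where x = "Suc i"])
    then have "(is_north (p, q) (\<omega> ! Suc i) \<or> is_east (p, q) (\<omega> ! Suc i)) \<or>
        (is_south_east (p, q) (\<omega> ! Suc i) \<or> is_null (p, q) (\<omega> ! Suc i))"
      by (auto simp: D_edges_def s)
    then show ?thesis
      \<comment> \<open>Rewriting with \<open>eq\<close> makes both diagrams speak of the statistics
        of one and the same partition.\<close>
      using path_diagram_statistics[OF D that s, unfolded eq]
        path_diagram_statistics[OF D' that s[unfolded \<omega>]] \<omega>
      by (elim disjE[of "_ \<or> _"]) auto
  qed
  ultimately show "\<omega> = \<omega>' \<and> \<xi> = \<xi>'" using len by (auto intro: nth_equalityI)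
qed

section \<open>Surjectivity\<close>

text \<open>Passing from \<open>i\<close> to \<open>Suc i\<close> affects only the block containing
  \<open>Suc i\<close>: it appears as a new set if it has no smaller element, and otherwise is an
  opened set that grows.\<close>

lemma restrict_ordered_partition_step:
  assumes "\<pi> \<in> ordered_partitions n k" "i < n"
  defines "T \<equiv> restrict_trace i (closed_trace \<pi>)"
    and "T' \<equiv> restrict_trace (Suc i) (closed_trace \<pi>)"
  shows "\<exists>x. inserts (Suc i) x T T' \<or> extends (Suc i) x T T'"
proof -
  obtain L B M where \<pi>: "\<pi> = L @ B # M" and B: "Suc i \<in> B"
    and LM: "\<forall>C\<in>set L \<union> set M. Suc i \<notin> C"
    using ordered_partitionD(3)[OF assms(1), of "Suc i"] assms(2) by auto
  define us vs where "us = restrict_trace i (closed_trace L)"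
    and "vs = restrict_trace i (closed_trace M)"
  have "restrict_trace (Suc i) (closed_trace L) = us" "restrict_trace (Suc i) (closed_trace M) = vs"
    unfolding us_def vs_def
    by (rule restrict_trace_Suc, use LM in \<open>auto simp: closed_trace_def\<close>)+
  moreover have ins: "B \<inter> {..Suc i} = insert (Suc i) (B \<inter> {..i})" using B by (auto simp: atMost_Suc)
  ultimately obtain l where T': "T' = us @ (insert (Suc i) (B \<inter> {..i}), l) # vs"
    by (simp add: T'_def \<pi>)
  show ?thesis
  proof (cases "B \<inter> {..i} = {}")
    case True
    then have "T = us @ vs" by (simp add: T_def \<pi> us_def vs_def)
    then show ?thesis using T' True unfolding inserts_def by auto
  next
    case False
    \<comment> \<open>Since \<open>Suc i\<close> is still missing, the restriction at
      \<open>i\<close> labels this set \<open>Opened\<close>, as \<open>extends\<close>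
      demands.\<close>
    moreover have "\<not> B \<subseteq> {..i}" using B by auto
    ultimately have "T = us @ (B \<inter> {..i}, Opened) # vs" by (simp add: T_def \<pi> us_def vs_def)
    then show ?thesis using T' unfolding extends_def by blast
  qed
qed

lemma psi_surj:
  assumes "\<pi> \<in> ordered_partitions n k"
  shows "\<exists>d\<in>path_diagrams n k. psi d = \<pi>"
proof -
  define T where "T i = restrict_trace i (closed_trace \<pi>)" for i
  \<comment> \<open>The only possible preimage path: vertices are read off from the restrictions of
    the partition.\<close>
  define \<omega> where "\<omega> = map (\<lambda>i. trace_vertex (T i)) [0..<n + 1]"
  have \<omega>: "\<omega> ! i = trace_vertex (T i)" if "i \<le> n" for i
    using that by (simp add: \<omega>_def del: upt_Suc)
  \<comment> \<open>A weight is chosen for every step at once; these become the entries of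
    \<open>\<xi>\<close>.\<close>
  obtain x where x: "\<And>i. i < n \<Longrightarrow> inserts (Suc i) (x i) (T i) (T (Suc i)) \<or>
      extends (Suc i) (x i) (T i) (T (Suc i))"
    using restrict_ordered_partition_step[OF assms] unfolding T_def by metis
  define \<xi> where "\<xi> = map x [0..<n]"
  have \<xi>: "\<xi> ! i = x i" if "i < n" for i using that by (simp add: \<xi>_def)
  have blocks: "\<forall>C\<in>set \<pi>. C \<noteq> {} \<and> C \<subseteq> {1..n}" and len: "length \<pi> = k"
    using ordered_partitionD(2)[OF assms] assms by (auto simp: ordered_partitions_def)
  have T0: "T 0 = []"
    using blocks unfolding T_def restrict_trace_def closed_trace_def
    by (fastforce simp: filter_empty_conv)
  have Tn: "T n = closed_trace \<pi>"
    unfolding T_def by (rule restrict_trace_id) (use blocks in \<open>fastforce simp: closed_trace_def\<close>)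
  \<comment> \<open>The coordinate sum is the number of sets in the restriction, and restricting
    never creates sets beyond the \<open>k\<close> blocks.\<close>
  have verts: "trace_vertex (T i) \<in> D_verts k" for i
  proof -
    have "length (T i) \<le> k"
      unfolding T_def restrict_trace_def using len length_filter_le[of _ "closed_trace \<pi>"] by simp
    then show ?thesis using closed_plus_opened_count[of "T i"]
      by (simp add: trace_vertex_def D_verts_def)
  qed
  have step: "(\<omega> ! i, \<omega> ! Suc i) \<in> D_edges k \<and>
      (\<forall>p q. \<omega> ! i = (p, q) \<longrightarrow>
         (is_null (p, q) (\<omega> ! Suc i) \<or> is_south_east (p, q) (\<omega> ! Suc i) \<longrightarrow>
            1 \<le> \<xi> ! i \<and> \<xi> ! i \<le> q) \<and>
         (is_north (p, q) (\<omega> ! Suc i) \<or> is_east (p, q) (\<omega> ! Suc i) \<longrightarrow>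
            1 \<le> \<xi> ! i \<and> \<xi> ! i \<le> p + q + 1)) \<and>
      T (Suc i) = trace_step (\<omega> ! i) (\<omega> ! Suc i) (\<xi> ! i) (Suc i) (T i)" if "i < n" for i
  proof -
    have s: "\<omega> ! i = trace_vertex (T i)" and t: "\<omega> ! Suc i = trace_vertex (T (Suc i))"
      using that \<omega> by auto
    show ?thesis
      using x[OF that]
    proof
      assume "inserts (Suc i) (x i) (T i) (T (Suc i))"
      note facts = inserts_trace_step[OF this, folded s t \<xi>[OF that]]
      show ?thesis
        using facts verts[of i, folded s] verts[of "Suc i", folded t]
        by (auto simp: D_edges_def step_defs)
    next
      assume "extends (Suc i) (x i) (T i) (T (Suc i))"
      note facts = extends_trace_step[OF this, folded s t \<xi>[OF that]]
      show ?thesis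
        using facts verts[of i, folded s] verts[of "Suc i", folded t]
        by (auto simp: D_edges_def step_defs)
    qed
  qed
  have "\<omega> ! 0 = (0, 0)" "\<omega> ! n = (k, 0)"
    using \<omega>[of 0] \<omega>[of n] len by (auto simp: T0 Tn trace_vertex_def)
  moreover have "set \<omega> \<subseteq> D_verts k" using verts by (auto simp: \<omega>_def simp del: upt_Suc)
  moreover have "(\<omega> ! (i - 1), \<omega> ! i) \<in> D_edges k" if "i \<in> {1..n}" for i
  proof -
    have "i - 1 < n" "Suc (i - 1) = i" using that by auto
    then show ?thesis using step[of "i - 1"] by metis
  qed
  ultimately have "\<omega> \<in> paths n k" by (simp add: paths_def \<omega>_def del: upt_Suc)
  moreover have "length \<xi> = n" by (simp add: \<xi>_def)
  moreover have "\<forall>p q. \<omega> ! (i - 1) = (p, q) \<longrightarrow>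
          (is_null (p, q) (\<omega> ! i) \<or> is_south_east (p, q) (\<omega> ! i)
             \<longrightarrow> 1 \<le> \<xi> ! (i - 1) \<and> \<xi> ! (i - 1) \<le> q)
        \<and> (is_north (p, q) (\<omega> ! i) \<or> is_east (p, q) (\<omega> ! i)
             \<longrightarrow> 1 \<le> \<xi> ! (i - 1) \<and> \<xi> ! (i - 1) \<le> p + q + 1)" if "i \<in> {1..n}" for i
  proof -
    have "i - 1 < n" "Suc (i - 1) = i" using that by auto
    then show ?thesis using step[of "i - 1"] by metis
  qed
  ultimately have "(\<omega>, \<xi>) \<in> path_diagrams n k" unfolding path_diagrams_def by blast
  \<comment> \<open>Replaying the steps read off from the partition rebuilds its restrictions one
    after another, ending with the partition itself.\<close>
  moreover have "trace_of \<omega> \<xi> i = T i" if "i \<le> n" for i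
    using that
  proof (induction i)
    case (Suc i)
    then show ?case using step[of i] by simp
  qed (simp add: T0)
  then have "psi (\<omega>, \<xi>) = \<pi>" using \<open>length \<xi> = n\<close> by (simp add: psi_def Tn)
  ultimately show ?thesis by blast
qed

section \<open>Bijectivity together with the statistics\<close>

lemma bij_betw_psi: "bij_betw psi (path_diagrams n k) (ordered_partitions n k)"
  unfolding bij_betw_def
proof (intro conjI equalityI subsetI)
  fix \<pi> assume "\<pi> \<in> psi ` path_diagrams n k"
  then show "\<pi> \<in> ordered_partitions n k" using psi_path_diagram(1) by auto
next
  fix \<pi> assume "\<pi> \<in> ordered_partitions n k"
  then show "\<pi> \<in> psi ` path_diagrams n k" using psi_surj by blast
qed (rule inj_on_psi)

theorem theorem3p6:
  fixes n k :: nat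
  assumes "1 \<le> k" and "k \<le> n"
  shows "bij_betw psi (path_diagrams n k) (ordered_partitions n k)
    \<and> (\<forall>\<omega> \<xi> \<pi>. (\<omega>, \<xi>) \<in> path_diagrams n k \<and> \<pi> = psi (\<omega>, \<xi>) \<longrightarrow>
        (\<forall>i\<in>{1..n}. \<forall>p q. \<omega> ! (i - 1) = (p, q) \<longrightarrow>
           (is_north (p, q) (\<omega> ! i) \<or> is_east (p, q) (\<omega> ! i) \<longrightarrow>
              i \<in> strict_openers \<pi> \<union> singletons \<pi>
            \<and> lcs \<pi> i + rcs \<pi> i = p
            \<and> lsb \<pi> i + rsb \<pi> i = q
            \<and> int (los \<pi> i) = int (\<xi> ! (i - 1)) - 1
            \<and> int (ros \<pi> i) = int p + int q + 1 - int (\<xi> ! (i - 1)))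
         \<and> (is_south_east (p, q) (\<omega> ! i) \<or> is_null (p, q) (\<omega> ! i) \<longrightarrow>
              i \<in> transients \<pi> \<union> strict_closers \<pi>
            \<and> lcs \<pi> i + rcs \<pi> i = p
            \<and> int (lsb \<pi> i + rsb \<pi> i) = int q - 1
            \<and> int (lsb \<pi> i) = int (\<xi> ! (i - 1)) - 1
            \<and> int (rsb \<pi> i) = int q - int (\<xi> ! (i - 1)))))"
proof (rule conjI[OF bij_betw_psi], intro allI impI ballI, elim conjE)
  fix \<omega> \<xi> \<pi> i p q
  assume D: "(\<omega>, \<xi>) \<in> path_diagrams n k" and \<pi>: "\<pi> = psi (\<omega>, \<xi>)"
    and i: "i \<in> {1..n}" and s: "\<omega> ! (i - 1) = (p, q)"
  \<comment> \<open>Passage from the 1-based step number to the 0-based list index.\<close>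
  define j where "j = i - 1"
  have j: "j < n" "i = Suc j" using i by (auto simp: j_def)
  note stats = path_diagram_statistics[OF D j(1) s[folded j_def], folded \<pi>]
  show "(is_north (p, q) (\<omega> ! i) \<or> is_east (p, q) (\<omega> ! i) \<longrightarrow>
              i \<in> strict_openers \<pi> \<union> singletons \<pi>
            \<and> lcs \<pi> i + rcs \<pi> i = p
            \<and> lsb \<pi> i + rsb \<pi> i = q
            \<and> int (los \<pi> i) = int (\<xi> ! (i - 1)) - 1
            \<and> int (ros \<pi> i) = int p + int q + 1 - int (\<xi> ! (i - 1)))
         \<and> (is_south_east (p, q) (\<omega> ! i) \<or> is_null (p, q) (\<omega> ! i) \<longrightarrow>
              i \<in> transients \<pi> \<union> strict_closers \<pi>
            \<and> lcs \<pi> i + rcs \<pi> i = p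
            \<and> int (lsb \<pi> i + rsb \<pi> i) = int q - 1
            \<and> int (lsb \<pi> i) = int (\<xi> ! (i - 1)) - 1
            \<and> int (rsb \<pi> i) = int q - int (\<xi> ! (i - 1)))"
    unfolding j(2) diff_Suc_1
  proof (rule conjI; rule impI)
    assume "is_north (p, q) (\<omega> ! Suc j) \<or> is_east (p, q) (\<omega> ! Suc j)"
    \<comment> \<open>The additive equations over the naturals are solved for the statistics over
      the integers, where the subtractions are exact.\<close>
    from stats(1)[OF this] show "Suc j \<in> strict_openers \<pi> \<union> singletons \<pi>
            \<and> lcs \<pi> (Suc j) + rcs \<pi> (Suc j) = p
            \<and> lsb \<pi> (Suc j) + rsb \<pi> (Suc j) = q
            \<and> int (los \<pi> (Suc j)) = int (\<xi> ! j) - 1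
            \<and> int (ros \<pi> (Suc j)) = int p + int q + 1 - int (\<xi> ! j)"
      by linarith
  next
    assume "is_south_east (p, q) (\<omega> ! Suc j) \<or> is_null (p, q) (\<omega> ! Suc j)"
    from stats(2)[OF this] show "Suc j \<in> transients \<pi> \<union> strict_closers \<pi>
            \<and> lcs \<pi> (Suc j) + rcs \<pi> (Suc j) = p
            \<and> int (lsb \<pi> (Suc j) + rsb \<pi> (Suc j)) = int q - 1
            \<and> int (lsb \<pi> (Suc j)) = int (\<xi> ! j) - 1
            \<and> int (rsb \<pi> (Suc j)) = int q - int (\<xi> ! j)"
      by linarith
  qed
qed

end
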